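(* Let $a_1,\dots,a_n$ be positive integers and let $K_{a_1,\dots,a_n}$ be the complete $n$-partite graph whose parts have sizes $a_1,\dots,a_n$. Then the nim-value of $K_{a_1,\dots,a_n}$ in graph chomp equals the residue of $p$ modulo $3$, where $p$ is the number of indices $i$ for which $a_i$ is odd.
   Context: The complete $n$-partite graph $K_{a_1,\dots,a_n}$ has its vertex set partitioned into $n$ parts of sizes $a_1,\dots,a_n$, with two vertices adjacent if and only if they lie in different parts. Graph chomp is played on a finite simple graph: two players alternate, and a move consists either of deleting one edge, or of deleting one vertex together with all edges incident to it. The player who makes the last move wins. The nim-value $g$ of a position is defined recursively: the empty graph has nim-value $0$, and $g(G)$ is the minimal nonnegative integer not equal to the nim-value of any position reachable from $G$ in one move. *)

theory Defs
  imports "HOL-Library.Disjoint_Sets"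
begin

type_synonym 'a graph = "'a set \<times> 'a set set"

abbreviation verts :: "'a graph \<Rightarrow> 'a set" where
  "verts G \<equiv> fst G"

abbreviation edges :: "'a graph \<Rightarrow> 'a set set" where
  "edges G \<equiv> snd G"

definition finite_simple_graph :: "'a graph \<Rightarrow> bool" where
  "finite_simple_graph G \<longleftrightarrow>
     finite (verts G) \<and> (\<forall>e \<in> edges G. e \<subseteq> verts G \<and> card e = 2)"

definition delete_edge :: "'a graph \<Rightarrow> 'a set \<Rightarrow> 'a graph" where
  "delete_edge G e = (verts G, edges G - {e})"

definition delete_vertex :: "'a graph \<Rightarrow> 'a \<Rightarrow> 'a graph" where
  "delete_vertex G v = (verts G - {v}, {e \<in> edges G. v \<notin> e})"

inductive chomp_move :: "'a graph \<Rightarrow> 'a graph \<Rightarrow> bool" where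
  edge: "e \<in> edges G \<Longrightarrow> chomp_move G (delete_edge G e)"
| vertex: "v \<in> verts G \<Longrightarrow> chomp_move G (delete_vertex G v)"

definition mex :: "nat set \<Rightarrow> nat" where
  "mex S = (LEAST n. n \<notin> S)"

lemma finite_simple_graph_finite_edges:
  assumes "finite_simple_graph G"
  shows "finite (edges G)"
proof (rule finite_subset)
  show "edges G \<subseteq> Pow (verts G)" "finite (Pow (verts G))"
    using assms by (auto simp: finite_simple_graph_def)
qed

lemma finite_simple_graph_chomp_move:
  "chomp_move G H \<Longrightarrow> finite_simple_graph G \<Longrightarrow> finite_simple_graph H"
  by (induction rule: chomp_move.induct)
     (auto simp: finite_simple_graph_def delete_edge_def delete_vertex_def)

lemma chomp_move_size_less:
  assumes "finite_simple_graph G" "chomp_move G H"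
  shows "card (verts H) + card (edges H) < card (verts G) + card (edges G)"
  using assms(2)
proof cases
  case (edge e)
  then show ?thesis
    using card_Diff1_less[OF finite_simple_graph_finite_edges[OF assms(1)], of e]
    by (simp add: delete_edge_def)
next
  case (vertex v)
  have "card (verts G - {v}) < card (verts G)"
    using assms(1) vertex by (intro card_Diff1_less) (auto simp: finite_simple_graph_def)
  moreover have "card {e \<in> edges G. v \<notin> e} \<le> card (edges G)"
    by (intro card_mono finite_simple_graph_finite_edges[OF assms(1)]) auto
  ultimately show ?thesis
    using vertex by (simp add: delete_vertex_def)
qed

text \<open>
  The guard is needed only for termination. Moves preserve finite simple graphs
  (\<open>finite_simple_graph_chomp_move\<close>), so on such graphs the defining recursion is
  the one in \<open>nim_value_eq\<close>.
\<close>

function nim_value :: "'a graph \<Rightarrow> nat" where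
  "nim_value G =
     (if finite_simple_graph G then mex (nim_value ` {H. chomp_move G H}) else undefined)"
  by pat_completeness auto
termination
proof (relation "measure (\<lambda>G. card (verts G) + card (edges G))")
  fix G H :: "'a graph"
  assume "finite_simple_graph G" "H \<in> {H. chomp_move G H}"
  then show "(H, G) \<in> measure (\<lambda>G. card (verts G) + card (edges G))"
    using chomp_move_size_less[of G H] by simp
qed simp

declare nim_value.simps [simp del]

lemma nim_value_eq:
  "finite_simple_graph G \<Longrightarrow> nim_value G = mex (nim_value ` {H. chomp_move G H})"
  by (subst nim_value.simps) (rule if_P)

lemma nim_value_empty: "nim_value (({}, {}) :: 'a graph) = 0"
proof -
  let ?G = "({}, {}) :: 'a graph"
  have no_moves: "{H. chomp_move ?G H} = {}"
    by (auto elim: chomp_move.cases)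
  have "nim_value ?G = mex (nim_value ` {H. chomp_move ?G H})"
    by (rule nim_value_eq) (simp add: finite_simple_graph_def)
  then show ?thesis
    unfolding no_moves by (simp add: mex_def)
qed

text \<open>
  A complete multipartite graph is determined by its part sizes only up to isomorphism, so
  this is a predicate on graphs over an arbitrary vertex type rather than one chosen graph.
\<close>

definition complete_multipartite :: "nat \<Rightarrow> (nat \<Rightarrow> nat) \<Rightarrow> 'a graph \<Rightarrow> bool" where
  "complete_multipartite n a G \<longleftrightarrow>
     (\<exists>P :: nat \<Rightarrow> 'a set.
        disjoint_family_on P {1..n} \<and>
        (\<forall>i \<in> {1..n}. finite (P i) \<and> card (P i) = a i) \<and>
        verts G = (\<Union>i \<in> {1..n}. P i) \<and>
        edges G = {{u, v} | u v. \<exists>i \<in> {1..n}. \<exists>j \<in> {1..n}. i \<noteq> j \<and> u \<in> P i \<and> v \<in> P j})"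

lemma complete_multipartite_finite_simple_graph:
  assumes "complete_multipartite n a G"
  shows "finite_simple_graph G"
proof -
  obtain P where P: "disjoint_family_on P {1..n}" "\<forall>i \<in> {1..n}. finite (P i)"
    "verts G = (\<Union>i \<in> {1..n}. P i)"
    "edges G = {{u, v} | u v. \<exists>i \<in> {1..n}. \<exists>j \<in> {1..n}. i \<noteq> j \<and> u \<in> P i \<and> v \<in> P j}"
    using assms unfolding complete_multipartite_def by (elim exE conjE) simp_all
  have "e \<subseteq> verts G \<and> card e = 2" if edge: "e \<in> edges G" for e
  proof -
    obtain u v i j where e: "e = {u, v}" "i \<in> {1..n}" "j \<in> {1..n}" "i \<noteq> j" "u \<in> P i" "v \<in> P j"
      using edge unfolding P(4) by blast
    then have "u \<noteq> v"
      using P(1) unfolding disjoint_family_on_def by blast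
    then show ?thesis
      using e P(3) by auto
  qed
  then show ?thesis
    using P(2,3) by (simp add: finite_simple_graph_def)
qed

lemma complete_multipartite_exists: "\<exists>G :: (nat \<times> nat) graph. complete_multipartite n a G"
proof -
  let ?P = "\<lambda>i. {i} \<times> {..<a i}"
  have "complete_multipartite n a
    (\<Union>i \<in> {1..n}. ?P i,
     {{u, v} | u v. \<exists>i \<in> {1..n}. \<exists>j \<in> {1..n}. i \<noteq> j \<and> u \<in> ?P i \<and> v \<in> ?P j})"
    unfolding complete_multipartite_def fst_conv snd_conv
    by (intro exI[of _ ?P] conjI refl) (auto simp: disjoint_family_on_def)
  then show ?thesis by blast
qed

end

theory Submission
  imports Defs "HOL-Combinatorics.Transposition"
begin

text \<open>
  An involutive automorphism that never maps a vertex to one of its neighbours can be used for a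
  pairing strategy: every move outside the fixed part can be answered by its mirror image, so the
  nim-value of the graph is that of its fixed part. Exchanging two vertices of the same part
  is such an automorphism; hence two vertices of the same part can be discarded, and only
  \<open>K\<^sub>p\<close> is left. The moves from \<open>K\<^sub>p\<close> lead to \<open>K\<^sub>p\<^sub>-\<^sub>1\<close> and, by
  deleting an edge \<open>uv\<close>, to a complete multipartite graph with a part \<open>{u, v}\<close>, which again
  reduces to \<open>K\<^sub>p\<^sub>-\<^sub>2\<close>. The recursion \<open>g\<^sub>p = mex {g\<^sub>p\<^sub>-\<^sub>1, g\<^sub>p\<^sub>-\<^sub>2}\<close> has period 3.
\<close>

section \<open>Minimal excludants and the options of a position\<close>

lemma mex_eqI: "n \<notin> S \<Longrightarrow> (\<And>k. k < n \<Longrightarrow> k \<in> S) \<Longrightarrow> mex S = n"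
  unfolding mex_def by (rule Least_equality) (auto simp: not_less[symmetric])

lemma mex_notin: "finite S \<Longrightarrow> mex S \<notin> S"
  unfolding mex_def by (rule LeastI_ex) (rule ex_new_if_finite[OF infinite_UNIV_nat])

lemma less_mex_in: "k < mex S \<Longrightarrow> k \<in> S"
  unfolding mex_def using not_less_Least by blast

text \<open>For \<open>p \<ge> 2\<close> the residues of \<open>p - 1\<close>, \<open>p - 2\<close>
  and \<open>p\<close> exhaust 0, 1, 2, so the last is the one missing. The guards keep truncated
  subtraction from inventing options: the set is empty for \<open>p = 0\<close> and is {0} for
  \<open>p = 1\<close>.\<close>

lemma mex_pred_mod_3:
  "mex {k. p \<ge> 1 \<and> k = (p - 1) mod 3 \<or> p \<ge> 2 \<and> k = (p - 2) mod 3} = p mod 3"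
proof (cases "p \<ge> 2")
  case True
  then obtain m where p: "p = m + 2"
    using le_Suc_ex by (metis add.commute)
  have "m mod 3 = 0 \<or> m mod 3 = 1 \<or> m mod 3 = 2"
    by linarith
  then show ?thesis
    by (intro mex_eqI) (auto simp: p mod_Suc)
next
  case False
  then have "p = 0 \<or> p = 1"
    by linarith
  then show ?thesis
    by (auto intro!: mex_eqI)
qed

lemma chomp_moves_eq:
  "{H. chomp_move G H} = delete_edge G ` edges G \<union> delete_vertex G ` verts G"
  by (auto elim: chomp_move.cases intro: chomp_move.intros)

lemma finite_chomp_moves: "finite_simple_graph G \<Longrightarrow> finite {H. chomp_move G H}"
  using finite_simple_graph_finite_edges[of G]
  by (simp add: chomp_moves_eq finite_simple_graph_def)

lemma nim_value_move_neq:
  assumes "finite_simple_graph G" "chomp_move G H"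
  shows "nim_value H \<noteq> nim_value G"
proof -
  have "nim_value H \<in> nim_value ` {H. chomp_move G H}"
    using assms(2) by blast
  then show ?thesis
    using mex_notin[OF finite_imageI[OF finite_chomp_moves[OF assms(1)]]]
    by (metis nim_value_eq[OF assms(1)])
qed

lemma nim_value_less_move:
  assumes "finite_simple_graph G" "k < nim_value G"
  obtains H where "chomp_move G H" "nim_value H = k"
  using less_mex_in[of k "nim_value ` {H. chomp_move G H}"] assms
  by (auto simp: nim_value_eq[OF assms(1)])


section \<open>Pairing strategies\<close>

text \<open>Inclusions suffice for an automorphism because \<open>f\<close> is an involution. The
  last condition excludes edges that are their own mirror image without being fixed pointwise; such
  a move would have no mirror reply.\<close>

definition pairing :: "('a \<Rightarrow> 'a) \<Rightarrow> 'a graph \<Rightarrow> bool" where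
  "pairing f G \<longleftrightarrow> (\<forall>v. f (f v) = v) \<and> f ` verts G \<subseteq> verts G \<and>
     (\<forall>e \<in> edges G. f ` e \<in> edges G) \<and> (\<forall>v. {v, f v} \<notin> edges G)"

definition fixed_part :: "('a \<Rightarrow> 'a) \<Rightarrow> 'a graph \<Rightarrow> 'a graph" where
  "fixed_part f G = ({v \<in> verts G. f v = v}, {e \<in> edges G. \<forall>v \<in> e. f v = v})"

lemma finite_simple_graph_fixed_part:
  "finite_simple_graph G \<Longrightarrow> finite_simple_graph (fixed_part f G)"
  unfolding finite_simple_graph_def fixed_part_def by auto

lemma pairing_image_eq_iff:
  assumes "pairing f G"
  shows "f ` d = e \<longleftrightarrow> d = f ` e"
proof -
  have "f ` f ` x = x" for x
    using assms by (simp add: pairing_def image_image)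
  then show ?thesis by metis
qed

text \<open>An invariant edge containing a moved vertex x would have to be {x, f x}, which a pairing
  forbids. Hence the mirror image of a deleted edge is still there to be deleted.\<close>

lemma pairing_edge_image_neq:
  assumes "finite_simple_graph G" "pairing f G" "e \<in> edges G" "\<not> (\<forall>v \<in> e. f v = v)"
  shows "f ` e \<noteq> e"
proof
  assume image: "f ` e = e"
  obtain x where x: "x \<in> e" "f x \<noteq> x"
    using assms(4) by blast
  obtain u v where "e = {u, v}"
    using assms(1,3) by (auto simp: finite_simple_graph_def card_2_iff)
  then have "e = {x, f x}"
    using x image by auto
  then show False
    using assms(2,3) by (auto simp: pairing_def)
qed

text \<open>The deleted edge is its own mirror image, so the symmetry survives and the move is a
  move of the fixed part.\<close>

lemma pairing_delete_fixed_edge: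
  assumes "pairing f G" "\<forall>v \<in> e. f v = v"
  shows "pairing f (delete_edge G e)"
    "fixed_part f (delete_edge G e) = delete_edge (fixed_part f G) e"
proof -
  have "f ` e = e"
    using assms(2) by auto
  then have "f ` d \<noteq> e" if "d \<noteq> e" for d
    using that pairing_image_eq_iff[OF assms(1), of d e] by simp
  then show "pairing f (delete_edge G e)"
    using assms(1) by (simp add: pairing_def delete_edge_def)
  show "fixed_part f (delete_edge G e) = delete_edge (fixed_part f G) e"
    by (auto simp: fixed_part_def delete_edge_def)
qed

lemma pairing_delete_fixed_vertex:
  assumes "pairing f G" "f v = v"
  shows "pairing f (delete_vertex G v)"
    "fixed_part f (delete_vertex G v) = delete_vertex (fixed_part f G) v"
proof -
  show "pairing f (delete_vertex G v)"
    using assms by (auto simp: pairing_def delete_vertex_def)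
  show "fixed_part f (delete_vertex G v) = delete_vertex (fixed_part f G) v"
    by (auto simp: fixed_part_def delete_vertex_def)
qed

text \<open>A move together with its mirror reply restores the symmetry, and neither of the two
  touches the fixed part.\<close>

lemma pairing_delete_edge_pair:
  assumes "pairing f G" "\<not> (\<forall>v \<in> e. f v = v)"
  shows "pairing f (delete_edge (delete_edge G e) (f ` e))"
    "fixed_part f (delete_edge (delete_edge G e) (f ` e)) = fixed_part f G"
proof -
  have "f ` d \<noteq> e \<and> f ` d \<noteq> f ` e" if "d \<noteq> e" "d \<noteq> f ` e" for d
    using that pairing_image_eq_iff[OF assms(1)] by metis
  then show "pairing f (delete_edge (delete_edge G e) (f ` e))"
    using assms(1) by (simp add: pairing_def delete_edge_def)
  have "f (f v) = v" for v
    using assms(1) by (simp add: pairing_def)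
  then have "\<not> (\<forall>v \<in> f ` e. f v = v)"
    using assms(2) by (metis imageI)
  then show "fixed_part f (delete_edge (delete_edge G e) (f ` e)) = fixed_part f G"
    using assms(2) by (auto simp: fixed_part_def delete_edge_def)
qed

lemma pairing_delete_vertex_pair:
  assumes "pairing f G" "f v \<noteq> v"
  shows "pairing f (delete_vertex (delete_vertex G v) (f v))"
    "fixed_part f (delete_vertex (delete_vertex G v) (f v)) = fixed_part f G"
proof -
  show "pairing f (delete_vertex (delete_vertex G v) (f v))"
    using assms by (auto simp: pairing_def delete_vertex_def) metis+
  have "f (f v) \<noteq> f v"
    using assms by (simp add: pairing_def)
  then show "fixed_part f (delete_vertex (delete_vertex G v) (f v)) = fixed_part f G"
    using assms(2) by (auto simp: fixed_part_def delete_vertex_def)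
qed

text \<open>Two facts characterize the mex: no option of \<open>G\<close> has the value of the fixed
  part (\<open>neq\<close>), and every option of the fixed part has its value attained by an option
  of \<open>G\<close> (\<open>lift\<close>).\<close>

lemma nim_value_fixed_part:
  assumes "finite_simple_graph G" "pairing f G"
  shows "nim_value G = nim_value (fixed_part f G)"
  using assms
proof (induction "card (verts G) + card (edges G)" arbitrary: G rule: less_induct)
  case less
  let ?F = "fixed_part f G"
  note G = \<open>finite_simple_graph G\<close> and pair = \<open>pairing f G\<close>
  note F = finite_simple_graph_fixed_part[OF G, of f]
  have IH: "nim_value H = nim_value (fixed_part f H)" if "chomp_move G H" "pairing f H" for H
    using less.hyps chomp_move_size_less[OF G] finite_simple_graph_chomp_move that G by blast
  \<comment> \<open>After an unanswered move the position need not be symmetric, so the induction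
    hypothesis is applied only after the reply, two moves below \<open>G\<close>.\<close>
  have IH2: "nim_value K = nim_value (fixed_part f K)"
    if "chomp_move G H" "chomp_move H K" "pairing f K" for H K
    using that less.hyps[of K] chomp_move_size_less[of G H] chomp_move_size_less[of H K]
      finite_simple_graph_chomp_move[of G H] finite_simple_graph_chomp_move[of H K] G
    by linarith
  have neq: "nim_value H \<noteq> nim_value ?F" if move: "chomp_move G H" for H
  proof -
    have H: "finite_simple_graph H"
      using finite_simple_graph_chomp_move[OF move G] .
    \<comment> \<open>The reply gives \<open>H\<close> an option with the value of
      \<open>?F\<close>, and no position shares its value with one of its options.\<close>
    have answered: ?thesis if "chomp_move H K" "pairing f K" "fixed_part f K = ?F" for K
      using nim_value_move_neq[OF H that(1)] IH2[OF move that(1,2)] that(3) by simp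
    \<comment> \<open>Here \<open>H\<close> has the value of an option of \<open>?F\<close>, which
      differs from that of \<open>?F\<close>.\<close>
    have inside: ?thesis if "pairing f H" "chomp_move ?F (fixed_part f H)"
      using nim_value_move_neq[OF F that(2)] IH[OF move that(1)] by simp
    from move show ?thesis
    proof cases
      case (edge e)
      show ?thesis
      proof (cases "\<forall>v \<in> e. f v = v")
        case True
        then have "e \<in> edges ?F"
          using edge by (simp add: fixed_part_def)
        then show ?thesis
          using pairing_delete_fixed_edge[OF pair True] edge(1)
          by (intro inside) (auto intro: chomp_move.edge)
      next
        case False
        then have "f ` e \<in> edges H"
          using pairing_edge_image_neq[OF G pair edge(2)] pair edge
          by (auto simp: delete_edge_def pairing_def)
        then show ?thesis
          using pairing_delete_edge_pair[OF pair False] edge(1)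
          by (intro answered[of "delete_edge H (f ` e)"]) (auto intro: chomp_move.edge)
      qed
    next
      case (vertex v)
      show ?thesis
      proof (cases "f v = v")
        case True
        then have "v \<in> verts ?F"
          using vertex by (simp add: fixed_part_def)
        then show ?thesis
          using pairing_delete_fixed_vertex[OF pair True] vertex(1)
          by (intro inside) (auto intro: chomp_move.vertex)
      next
        case False
        then have "f v \<in> verts H"
          using pair vertex by (auto simp: delete_vertex_def pairing_def)
        then show ?thesis
          using pairing_delete_vertex_pair[OF pair False] vertex(1)
          by (intro answered[of "delete_vertex H (f v)"]) (auto intro: chomp_move.vertex)
      qed
    qed
  qed
  have lift: "\<exists>H. chomp_move G H \<and> nim_value H = nim_value K" if "chomp_move ?F K" for K
    using that
  proof cases
    case (edge e)
    then have e: "e \<in> edges G" "\<forall>v \<in> e. f v = v"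
      by (auto simp: fixed_part_def)
    show ?thesis
      using IH[OF chomp_move.edge[OF e(1)]] pairing_delete_fixed_edge[OF pair e(2)] edge(1)
        chomp_move.edge[OF e(1)] by metis
  next
    case (vertex v)
    then have v: "v \<in> verts G" "f v = v"
      by (auto simp: fixed_part_def)
    show ?thesis
      using IH[OF chomp_move.vertex[OF v(1)]] pairing_delete_fixed_vertex[OF pair v(2)] vertex(1)
        chomp_move.vertex[OF v(1)] by metis
  qed
  show ?case
    unfolding nim_value_eq[OF G]
  proof (rule mex_eqI)
    show "nim_value ?F \<notin> nim_value ` {H. chomp_move G H}"
      using neq by fastforce
    show "k \<in> nim_value ` {H. chomp_move G H}" if k: "k < nim_value ?F" for k
    proof -
      obtain K where "chomp_move ?F K" "nim_value K = k"
        by (rule nim_value_less_move[OF F k])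
      then show ?thesis
        using lift[of K] by (metis imageI mem_Collect_eq)
    qed
  qed
qed


section \<open>Complete multipartite graphs\<close>

text \<open>The parts are the color classes. Empty classes are harmless, so deleting vertices only
  shrinks \<open>V\<close>, and merging parts is recoloring.\<close>

definition colored_graph :: "'a set \<Rightarrow> ('a \<Rightarrow> 'b) \<Rightarrow> 'a graph" where
  "colored_graph V c = (V, {{u, v} | u v. u \<in> V \<and> v \<in> V \<and> c u \<noteq> c v})"

definition odd_colors :: "'a set \<Rightarrow> ('a \<Rightarrow> 'b) \<Rightarrow> 'b set" where
  "odd_colors V c = {i. odd (card {v \<in> V. c v = i})}"

lemma finite_simple_graph_colored_graph:
  "finite V \<Longrightarrow> finite_simple_graph (colored_graph V c)"
  unfolding finite_simple_graph_def colored_graph_def by (auto simp: card_2_iff)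

lemma delete_vertex_colored_graph:
  "delete_vertex (colored_graph V c) v = colored_graph (V - {v}) c"
  unfolding delete_vertex_def colored_graph_def by auto

text \<open>Under an injective coloring the graph is complete. No third vertex shares a color with u
  or v, so giving u the color of v destroys only the adjacency of these two.\<close>

lemma delete_edge_colored_graph:
  assumes "inj_on c V" "u \<in> V" "v \<in> V"
  shows "delete_edge (colored_graph V c) {u, v} = colored_graph V (c(u := c v))"
proof -
  define d where "d = c(u := c v)"
  have d: "d x \<noteq> d y \<longleftrightarrow> c x \<noteq> c y \<and> {x, y} \<noteq> {u, v}" if "x \<in> V" "y \<in> V" for x y
    unfolding d_def using assms that by (auto simp: inj_on_eq_iff doubleton_eq_iff)
  have "{{x, y} | x y. x \<in> V \<and> y \<in> V \<and> c x \<noteq> c y} - {{u, v}} =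
      {{x, y} | x y. x \<in> V \<and> y \<in> V \<and> c x \<noteq> c y \<and> {x, y} \<noteq> {u, v}}"
    by blast
  also have "\<dots> = {{x, y} | x y. x \<in> V \<and> y \<in> V \<and> d x \<noteq> d y}"
    using d by (intro Collect_cong iff_exI) blast
  finally show ?thesis
    by (simp add: delete_edge_def colored_graph_def d_def)
qed

text \<open>The transposition of u and v preserves colors and moves only these two nonadjacent
  vertices, so it is a pairing whose fixed part is the rest of the graph.\<close>

lemma nim_value_colored_graph_remove_pair:
  assumes "finite V" "u \<in> V" "v \<in> V" "u \<noteq> v" "c u = c v"
  shows "nim_value (colored_graph V c) = nim_value (colored_graph (V - {u, v}) c)"
proof -
  let ?f = "transpose u v"
  have color: "c (?f x) = c x" for x
    using assms(5) by (auto simp: transpose_def)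
  have verts: "?f x \<in> V" if "x \<in> V" for x
    using assms(2,3) that by (auto simp: transpose_def)
  have "pairing ?f (colored_graph V c)"
    unfolding pairing_def colored_graph_def fst_conv snd_conv
  proof (intro conjI allI ballI)
    fix e assume "e \<in> {{x, y} | x y. x \<in> V \<and> y \<in> V \<and> c x \<noteq> c y}"
    then obtain x y where "e = {x, y}" "x \<in> V" "y \<in> V" "c x \<noteq> c y"
      by blast
    then show "?f ` e \<in> {{x, y} | x y. x \<in> V \<and> y \<in> V \<and> c x \<noteq> c y}"
      using verts[of x] verts[of y] color[of x] color[of y] 
      by (metis (mono_tags, lifting) CollectI image_empty image_insert)
  qed (use verts color in \<open>auto simp: doubleton_eq_iff\<close>)
  moreover have "fixed_part ?f (colored_graph V c) = colored_graph (V - {u, v}) c"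
  proof -
    have "?f x = x \<longleftrightarrow> x \<notin> {u, v}" for x
      using assms(4) by (auto simp: transpose_def)
    then show ?thesis
      by (auto simp: fixed_part_def colored_graph_def)
  qed
  ultimately show ?thesis
    using nim_value_fixed_part[OF finite_simple_graph_colored_graph[OF assms(1)]] by metis
qed

lemma odd_colors_remove_pair:
  assumes "finite V" "u \<in> V" "v \<in> V" "u \<noteq> v" "c u = c v"
  shows "odd_colors (V - {u, v}) c = odd_colors V c"
proof -
  have "odd (card {x \<in> V - {u, v}. c x = i}) \<longleftrightarrow> odd (card {x \<in> V. c x = i})" for i
  proof (cases "c v = i")
    case True
    then have "{x \<in> V. c x = i} = insert u (insert v {x \<in> V - {u, v}. c x = i})"
      using assms by auto
    then show ?thesis
      using assms(1,4) by simp
  next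
    case False
    then have "{x \<in> V - {u, v}. c x = i} = {x \<in> V. c x = i}"
      using assms(5) by auto
    then show ?thesis by simp
  qed
  then show ?thesis
    by (simp add: odd_colors_def)
qed

lemma card_odd_colors_inj_on:
  assumes "inj_on c V"
  shows "card (odd_colors V c) = card V"
proof -
  have "card {v \<in> V. c v = i} = (if i \<in> c ` V then 1 else 0)" for i
  proof (cases "i \<in> c ` V")
    case True
    then obtain v where "v \<in> V" "c v = i" by blast
    then have "{v \<in> V. c v = i} = {v}"
      using assms by (auto simp: inj_on_def)
    then show ?thesis
      using True by simp
  next
    case False
    then have "{v \<in> V. c v = i} = {}" by auto
    then show ?thesis
      using False by (simp only: card.empty if_False)
  qed
  then have "odd_colors V c = c ` V"
    by (auto simp: odd_colors_def)
  then show ?thesis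
    using card_image[OF assms] by simp
qed

text \<open>Induction on the number of vertices: either two vertices share a color and can be
  discarded together, or the graph is complete and its options are computed.\<close>

theorem nim_value_colored_graph:
  fixes c :: "'a \<Rightarrow> 'b"
  assumes "finite V"
  shows "nim_value (colored_graph V c) = card (odd_colors V c) mod 3"
  using assms
proof (induction "card V" arbitrary: V c rule: less_induct)
  case less
  note V = \<open>finite V\<close>
  show ?case
  proof (cases "inj_on c V")
    case False
    then obtain u v where uv: "u \<in> V" "v \<in> V" "u \<noteq> v" "c u = c v"
      by (auto simp: inj_on_def)
    moreover have "card (V - {u, v}) < card V"
      using V uv by (intro psubset_card_mono) auto
    ultimately show ?thesis
      using less.hyps[of "V - {u, v}" c] V
      by (simp add: nim_value_colored_graph_remove_pair odd_colors_remove_pair)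
  next
    case True
    let ?G = "colored_graph V c"
    have vertex_value: "nim_value (delete_vertex ?G v) = (card V - 1) mod 3" if "v \<in> V" for v
    proof -
      have "card (V - {v}) < card V"
        using V that by (intro psubset_card_mono) auto
      moreover have "inj_on c (V - {v})"
        using True by (rule inj_on_subset) auto
      ultimately show ?thesis
        using less.hyps[of "V - {v}" c] V that
        by (simp add: delete_vertex_colored_graph card_odd_colors_inj_on)
    qed
    have edge_value: "nim_value (delete_edge ?G {u, v}) = (card V - 2) mod 3"
      if "u \<in> V" "v \<in> V" "u \<noteq> v" for u v
    proof -
      let ?c = "c(u := c v)" and ?W = "V - {u, v}"
      have "card ?W < card V"
        using V that by (intro psubset_card_mono) auto
      \<comment> \<open>The recolored vertex u lies outside \<open>?W\<close>, where
        \<open>?c\<close> therefore agrees with \<open>c\<close>.\<close>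
      moreover have "inj_on ?c ?W"
        using True by (auto simp: inj_on_def)
      moreover have "nim_value (delete_edge ?G {u, v}) = nim_value (colored_graph ?W ?c)"
        unfolding delete_edge_colored_graph[OF True that(1,2)]
        using V that by (intro nim_value_colored_graph_remove_pair) auto
      moreover have "card ?W = card V - 2"
        using V that by (simp add: card_Diff_subset)
      ultimately show ?thesis
        using less.hyps[of ?W ?c] V by (simp add: card_odd_colors_inj_on)
    qed
    have edge_obtain: "\<exists>u v. e = {u, v} \<and> u \<in> V \<and> v \<in> V \<and> u \<noteq> v" if "e \<in> edges ?G" for e
      using that by (auto simp: colored_graph_def)
    have options: "nim_value ` {H. chomp_move ?G H} =
        {k. card V \<ge> 1 \<and> k = (card V - 1) mod 3 \<or> card V \<ge> 2 \<and> k = (card V - 2) mod 3}"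
      (is "?L = ?R")
    proof
      \<comment> \<open>A move certifies the guards in \<open>?R\<close>: an edge needs two
        vertices, a vertex deletion one.\<close>
      have "card {u, v} \<le> card V" if "u \<in> V" "v \<in> V" for u v
        using V that by (intro card_mono) auto
      then have two: "card V \<ge> 2" if "u \<in> V" "v \<in> V" "u \<noteq> v" for u v
        using that by fastforce
      have one: "card V \<ge> 1" if "v \<in> V" for v
        using V that card_gt_0_iff[of V] by force
      show "?L \<subseteq> ?R"
      proof
        fix k assume "k \<in> ?L"
        then obtain H where H: "chomp_move ?G H" "k = nim_value H"
          by blast
        from H(1) show "k \<in> ?R"
        proof cases
          case (edge e)
          then show ?thesis
            using edge_obtain[of e] two H(2) edge_value
            by blast
        next
          case (vertex v)
          then have "v \<in> V"
            by (simp add: colored_graph_def)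
          then show ?thesis
            using one H(2) vertex(1) vertex_value
            by blast
        qed
      qed
      have "(card V - 1) mod 3 \<in> ?L" if V1: "card V \<ge> 1"
      proof -
        obtain v where v: "v \<in> V"
          using V1 by fastforce
        then have "chomp_move ?G (delete_vertex ?G v)"
          by (intro chomp_move.vertex) (simp add: colored_graph_def)
        then show ?thesis
          using vertex_value[OF v] by (metis imageI mem_Collect_eq)
      qed
      moreover have "(card V - 2) mod 3 \<in> ?L" if V2: "card V \<ge> 2"
      proof -
        obtain T where "T \<subseteq> V" "card T = 2"
          using obtain_subset_with_card_n[OF V2] by blast
        then obtain u v where uv: "u \<in> V" "v \<in> V" "u \<noteq> v"
          by (auto simp: card_2_iff)
        then have "{u, v} \<in> edges ?G"
          using inj_onD[OF True, of u v] unfolding colored_graph_def snd_conv by blast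
        then have "chomp_move ?G (delete_edge ?G {u, v})"
          by (rule chomp_move.edge)
        then show ?thesis
          using edge_value[OF uv] by (metis imageI mem_Collect_eq)
      qed
      ultimately show "?R \<subseteq> ?L"
        by (intro subsetI) (elim CollectE disjE conjE; simp only:)
    qed
    show ?thesis
      unfolding nim_value_eq[OF finite_simple_graph_colored_graph[OF V]] options
        card_odd_colors_inj_on[OF True] by (rule mex_pred_mod_3)
  qed
qed

section \<open>Parts as color classes\<close>

lemma complete_multipartite_colored_graph:
  assumes "complete_multipartite n a G"
  obtains V and c :: "'a \<Rightarrow> nat" where "finite V" "G = colored_graph V c"
    "odd_colors V c = {i \<in> {1..n}. odd (a i)}"
proof -
  obtain P :: "nat \<Rightarrow> 'a set" where disj: "disjoint_family_on P {1..n}"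
    and P: "\<forall>i \<in> {1..n}. finite (P i) \<and> card (P i) = a i"
    and verts: "verts G = (\<Union>i \<in> {1..n}. P i)"
    and edges: "edges G =
      {{u, v} | u v. \<exists>i \<in> {1..n}. \<exists>j \<in> {1..n}. i \<noteq> j \<and> u \<in> P i \<and> v \<in> P j}"
    using assms unfolding complete_multipartite_def by (elim exE conjE)
  \<comment> \<open>The color of a vertex is the index of its part, unique by disjointness. Outside
    the vertex set the value is arbitrary, but only colors of vertices matter.\<close>
  define c where "c v = (THE i. i \<in> {1..n} \<and> v \<in> P i)" for v
  have c: "c v = i" if "i \<in> {1..n}" "v \<in> P i" for v i
    unfolding c_def
  proof (rule the_equality)
    show "j = i" if "j \<in> {1..n} \<and> v \<in> P j" for j
      using disj that \<open>i \<in> {1..n}\<close> \<open>v \<in> P i\<close>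
      unfolding disjoint_family_on_def by blast
  qed (use that in blast)
  have "{{u, v} | u v. \<exists>i \<in> {1..n}. \<exists>j \<in> {1..n}. i \<noteq> j \<and> u \<in> P i \<and> v \<in> P j} =
      {{u, v} | u v. u \<in> verts G \<and> v \<in> verts G \<and> c u \<noteq> c v}"
    (is "?E = ?E'")
  proof
    show "?E \<subseteq> ?E'"
    proof
      fix e assume "e \<in> ?E"
      then obtain u v i j
        where "e = {u, v}" "i \<in> {1..n}" "j \<in> {1..n}" "i \<noteq> j" "u \<in> P i" "v \<in> P j"
        by blast
      then show "e \<in> ?E'"
        using c[of i u] c[of j v] unfolding verts by blast
    qed
    show "?E' \<subseteq> ?E"
    proof
      fix e assume "e \<in> ?E'"
      then obtain u v i j
        where "e = {u, v}" "i \<in> {1..n}" "j \<in> {1..n}" "u \<in> P i" "v \<in> P j" "c u \<noteq> c v"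
        unfolding verts by blast
      then show "e \<in> ?E"
        using c[of i u] c[of j v] by blast
    qed
  qed
  then have "G = colored_graph (verts G) c"
    unfolding colored_graph_def edges[symmetric] by (simp add: prod_eq_iff)
  \<comment> \<open>Indices outside \<open>{1..n}\<close> give empty classes, which have even size
    and so add no odd color.\<close>
  moreover have "{v \<in> verts G. c v = i} = (if i \<in> {1..n} then P i else {})" for i
  proof (cases "i \<in> {1..n}")
    case True
    then show ?thesis
      unfolding verts using c by fastforce
  next
    case False
    then have "c v \<noteq> i" if "v \<in> verts G" for v
      using that c unfolding verts by blast
    then show ?thesis
      using False by auto
  qed
  then have "odd_colors (verts G) c = {i \<in> {1..n}. odd (a i)}"
    using P by (auto simp: odd_colors_def split: if_splits)
  moreover have "finite (verts G)"
    using P by (simp add: verts)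
  ultimately show thesis
    using that by blast
qed

theorem theorem2:
  fixes n :: nat and a :: "nat \<Rightarrow> nat" and G :: "'a graph"
  assumes "\<And>i. i \<in> {1..n} \<Longrightarrow> a i > 0"
    and "complete_multipartite n a G"
  shows "nim_value G = card {i \<in> {1..n}. odd (a i)} mod 3"
proof -
  obtain V and c :: "'a \<Rightarrow> nat" where "finite V" "G = colored_graph V c"
    "odd_colors V c = {i \<in> {1..n}. odd (a i)}"
    by (rule complete_multipartite_colored_graph[OF assms(2)])
  then show ?thesis
    using nim_value_colored_graph[of V c] by simp
qed

end
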